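(* Let $\mathcal{P}$ be a set of $n$ points in the Euclidean plane $\mathbb{R}^2$, and let $\mathcal{B}$ be the set of distinct perpendicular bisectors determined by pairs of distinct points of $\mathcal{P}$. If $n > 2$, then $|\mathcal{B}| \geq n$.
   Context: For two distinct points $a,b \in \mathbb{R}^2$, $B(a,b)$ denotes the perpendicular bisector of $a$ and $b$, i.e. the line of points equidistant from $a$ and $b$. The set of distinct perpendicular bisectors determined by $\mathcal{P}$ is $\mathcal{B} = \{B(a,b) : a,b \in \mathcal{P},\ a \neq b\}$, a set of lines (each line counted once). *)

theory Defs
  imports "HOL-Analysis.Analysis"
begin

definition perp_bisector :: "real^2 \<Rightarrow> real^2 \<Rightarrow> (real^2) set" where
  "perp_bisector a b = {x. dist x a = dist x b}"

text \<open>Lines are identified with their point sets, so coinciding bisectors are counted once.\<close>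

definition perp_bisectors :: "(real^2) set \<Rightarrow> (real^2) set set" where
  "perp_bisectors P = {perp_bisector a b | a b. a \<in> P \<and> b \<in> P \<and> a \<noteq> b}"

end

theory Submission
  imports Defs
begin

text \<open>
  Fix a point \<open>p\<close> of \<open>P\<close>. Since \<open>q\<close> is the mirror image of \<open>p\<close> in \<open>B(p,q)\<close>, the \<open>n - 1\<close>
  bisectors \<open>B(p,q)\<close> with \<open>q \<noteq> p\<close> are distinct, so only one line has to be gained. Suppose that
  there are no others. Then every line \<open>l\<close> of \<open>\<B>\<close> is, for every \<open>p\<close> in \<open>P\<close>, of the form
  \<open>B(p,q)\<close>: the reflection in \<open>l\<close> permutes \<open>P\<close> without fixed points, so no line of \<open>\<B>\<close> meets \<open>P\<close>
  (\<open>mirror_image_in_set\<close>). The contradiction is a line of \<open>\<B>\<close> through a point of \<open>P\<close>.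

  A symmetry of \<open>P\<close> fixes the centroid of \<open>P\<close>, so all lines of \<open>\<B>\<close> pass through the centroid, and
  \<open>P\<close> lies on a circle around it (\<open>concyclic_if_mirror_closed\<close>). Use complex coordinates with the
  centroid as the origin. On the circle, the reflection that exchanges \<open>a\<close> and \<open>b\<close> is
  \<open>z \<mapsto> a * b / z\<close> (\<open>coord_mult_eq_if_bisector_eq\<close>). For distinct \<open>a, b, c\<close> in \<open>P\<close>, apply to a point
  \<open>x\<close> of \<open>P\<close> the reflections that exchange \<open>a, c\<close>, then \<open>b, c\<close>, then \<open>a, b\<close>. The result is
  \<open>a\<^sup>2 / x\<close>, the mirror image of \<open>x\<close> in the diameter through \<open>a\<close>. Only the points \<open>a\<close> and \<open>- a\<close> of the
  circle lie on that diameter, so \<open>x = b\<close> or \<open>x = c\<close> differs from its image, and the diameter is a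
  bisector through \<open>a\<close> (\<open>equal_products_square\<close>).
\<close>

section \<open>Bisectors as lines\<close>

lemma mem_perp_bisector_iff:
  "x \<in> perp_bisector a b \<longleftrightarrow> 2 * (x \<bullet> (b - a)) = b \<bullet> b - a \<bullet> a"
proof -
  have "x \<in> perp_bisector a b \<longleftrightarrow> (dist x a)\<^sup>2 = (dist x b)\<^sup>2"
    by (simp add: perp_bisector_def)
  then show ?thesis
    by (simp add: dist_norm power2_norm_eq_inner algebra_simps inner_commute)
qed

lemma perp_bisector_commute: "perp_bisector a b = perp_bisector b a"
  by (auto simp: perp_bisector_def)

lemma midpoint_in_perp_bisector: "midpoint a b \<in> perp_bisector a b"
  by (simp add: perp_bisector_def dist_midpoint)

text \<open>
  The midpoints of \<open>z, q\<close> and of \<open>z, q'\<close> both lie on the common line. With \<open>u = q - z\<close> and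
  \<open>v = q' - z\<close> this says \<open>u \<bullet> v = v \<bullet> v\<close> and \<open>u \<bullet> v = u \<bullet> u\<close>, whence \<open>u = v\<close>.
\<close>
lemma perp_bisector_right_cancel:
  assumes "perp_bisector z q = perp_bisector z q'"
  shows "q = q'"
proof -
  have "midpoint z q \<in> perp_bisector z q'" "midpoint z q' \<in> perp_bisector z q"
    using assms midpoint_in_perp_bisector by blast+
  then have "(q - q') \<bullet> (q - q') = 0"
    by (simp add: mem_perp_bisector_iff midpoint_def algebra_simps inner_commute)
  then show ?thesis by simp
qed

lemma finite_perp_bisectors:
  assumes "finite P"
  shows "finite (perp_bisectors P)"
proof (rule finite_subset)
  show "perp_bisectors P \<subseteq> (\<lambda>(a, b). perp_bisector a b) ` (P \<times> P)"
    by (auto simp: perp_bisectors_def)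
qed (use assms in auto)

section \<open>Sets with fewer bisectors than points\<close>

text \<open>
  The \<open>card P - 1\<close> distinct bisectors that involve \<open>z\<close> already exhaust all bisectors.
\<close>
lemma mirror_image_in_set:
  assumes fin: "finite P" and few: "card (perp_bisectors P) < card P"
    and z: "z \<in> P" and l: "l \<in> perp_bisectors P"
  obtains q where "q \<in> P" "q \<noteq> z" "perp_bisector z q = l"
proof -
  have "inj_on (perp_bisector z) (P - {z})"
    by (auto intro: inj_onI perp_bisector_right_cancel)
  then have "card (perp_bisector z ` (P - {z})) = card P - 1"
    using fin z by (simp add: card_image)
  then have "perp_bisector z ` (P - {z}) = perp_bisectors P"
    using few z by (intro card_seteq finite_perp_bisectors fin) (auto simp: perp_bisectors_def)
  then have "l \<in> perp_bisector z ` (P - {z})" using l by simp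
  then show thesis using that by blast
qed

text \<open>
  The mirror images of the points of \<open>P\<close> in \<open>B(a,b)\<close> are the points of \<open>P\<close> in another order, so the
  centroid of \<open>P\<close> is also the mean of the midpoints between the points and their images. These
  midpoints all lie on \<open>B(a,b)\<close>, and so does their mean.
\<close>
lemma centroid_on_mirror:
  fixes P :: "(real^2) set"
  assumes fin: "finite P" and a: "a \<in> P"
    and mirror: "\<And>z. z \<in> P \<Longrightarrow> \<exists>q\<in>P. perp_bisector z q = perp_bisector a b"
  shows "(1 / real (card P)) *\<^sub>R \<Sum>P \<in> perp_bisector a b"
proof -
  obtain g where g: "\<And>z. z \<in> P \<Longrightarrow> g z \<in> P"
    and gl: "\<And>z. z \<in> P \<Longrightarrow> perp_bisector z (g z) = perp_bisector a b"
    using mirror by metis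
  have "inj_on g P"
  proof (rule inj_onI)
    fix x y assume xy: "x \<in> P" "y \<in> P" "g x = g y"
    then have "perp_bisector (g x) x = perp_bisector (g x) y"
      using gl perp_bisector_commute by metis
    then show "x = y" by (rule perp_bisector_right_cancel)
  qed
  then have "bij_betw g P P"
    using fin g by (simp add: bij_betw_def endo_inj_surj image_subsetI)
  then have sum_g: "(\<Sum>z\<in>P. g z) = \<Sum>P"
    by (rule sum.reindex_bij_betw[where g = "\<lambda>x. x"])
  have "(z + g z) \<bullet> (b - a) = b \<bullet> b - a \<bullet> a" if "z \<in> P" for z
    using midpoint_in_perp_bisector[of z "g z"] gl[OF that]
    by (simp add: mem_perp_bisector_iff midpoint_def)
  then have "(\<Sum>z\<in>P. (z + g z) \<bullet> (b - a)) = real (card P) * (b \<bullet> b - a \<bullet> a)"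
    by simp
  moreover have "(\<Sum>z\<in>P. (z + g z) \<bullet> (b - a)) = 2 * (\<Sum>P \<bullet> (b - a))"
    by (simp add: inner_sum_left[symmetric] sum.distrib sum_g inner_add_left)
  moreover have "card P \<noteq> 0" using fin a by auto
  ultimately show ?thesis
    by (simp add: mem_perp_bisector_iff field_simps)
qed

lemma concyclic_if_mirror_closed:
  fixes P :: "(real^2) set"
  assumes "finite P" and "P \<noteq> {}"
    and mirror: "\<And>a b z. \<lbrakk>a \<in> P; b \<in> P; a \<noteq> b; z \<in> P\<rbrakk> \<Longrightarrow>
      \<exists>q\<in>P. perp_bisector z q = perp_bisector a b"
  obtains m r where "\<And>p. p \<in> P \<Longrightarrow> dist m p = r"
proof -
  define m where "m = (1 / real (card P)) *\<^sub>R \<Sum>P"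
  obtain p0 where p0: "p0 \<in> P" using \<open>P \<noteq> {}\<close> by blast
  have "dist m p = dist m p0" if "p \<in> P" for p
  proof (cases "p = p0")
    case False
    then have "m \<in> perp_bisector p p0"
      unfolding m_def using assms(1) that p0 mirror by (intro centroid_on_mirror) auto
    then show ?thesis by (simp add: perp_bisector_def)
  qed simp
  then show thesis by (rule that)
qed

section \<open>Reflections of a circle in complex coordinates\<close>

definition coord :: "real^2 \<Rightarrow> real^2 \<Rightarrow> complex" where
  "coord m x = Complex (x $ 1 - m $ 1) (x $ 2 - m $ 2)"

lemma dist_coord: "dist (coord m x) (coord m y) = dist x y"
  by (simp add: coord_def dist_norm norm_vec_def L2_set_def sum_2 cmod_def)

lemma norm_coord: "norm (coord m x) = dist m x"
  by (simp add: coord_def dist_norm norm_vec_def L2_set_def sum_2 cmod_def power2_commute)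

lemma coord_eq_iff: "coord m x = coord m y \<longleftrightarrow> x = y"
  using dist_coord[of m x y] by (metis dist_eq_0_iff)

lemma surj_coord: "\<exists>x. coord m x = w"
  by (rule exI[of _ "vector [Re w + m $ 1, Im w + m $ 2]"]) (simp add: coord_def complex_eq_iff)

text \<open>
  The square roots of \<open>a * b\<close> are the midpoints of the two arcs between \<open>a\<close> and \<open>b\<close>. To see this,
  compare \<open>w * cnj a\<close> and \<open>w * cnj b\<close>: equal distances mean equal real parts, and two numbers
  of the same modulus with equal real parts are equal or conjugate.
\<close>
lemma circle_equidistant_iff:
  fixes w a b :: complex
  assumes "norm w = r" "norm a = r" "norm b = r" "r > 0"
  shows "dist w a = dist w b \<longleftrightarrow> a = b \<or> w\<^sup>2 = a * b"
proof -
  have nz: "w \<noteq> 0" "a \<noteq> 0" "b \<noteq> 0" using assms by auto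
  have sq: "w * cnj w = of_real (r\<^sup>2)" "a * cnj a = of_real (r\<^sup>2)" "b * cnj b = of_real (r\<^sup>2)"
    using assms complex_norm_square[of w] complex_norm_square[of a] complex_norm_square[of b]
    by simp_all
  have re: "(dist w x)\<^sup>2 = 2 * r\<^sup>2 - 2 * Re (w * cnj x)" if "norm x = r" for x
    using that assms(1) cmod_power2[of w] cmod_power2[of x] cmod_power2[of "w - x"]
    by (simp add: dist_norm power2_eq_square algebra_simps)
  have "dist w a = dist w b \<longleftrightarrow> (dist w a)\<^sup>2 = (dist w b)\<^sup>2" by simp
  also have "\<dots> \<longleftrightarrow> Re (w * cnj a) = Re (w * cnj b)" using re[of a] re[of b] assms by auto
  also have "\<dots> \<longleftrightarrow> w * cnj a = w * cnj b \<or> w * cnj a = cnj (w * cnj b)"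
  proof
    assume eq: "Re (w * cnj a) = Re (w * cnj b)"
    have "cmod (w * cnj a) = cmod (w * cnj b)" using assms by (simp add: norm_mult)
    then have "(Im (w * cnj a))\<^sup>2 = (Im (w * cnj b))\<^sup>2"
      using eq by (metis add_left_cancel cmod_power2)
    then show "w * cnj a = w * cnj b \<or> w * cnj a = cnj (w * cnj b)"
      using eq by (metis complex_eq_iff complex_cnj power2_eq_iff cnj.simps)
  qed (metis cnj.simps(1))
  also have "w * cnj a = w * cnj b \<longleftrightarrow> a = b" using nz by simp
  also have "w * cnj a = cnj (w * cnj b) \<longleftrightarrow> w\<^sup>2 = a * b"
  proof -
    have "w * cnj a = cnj (w * cnj b) \<longleftrightarrow> (w * a) * (w * cnj a) = (w * a) * (cnj w * b)"
      using nz by simp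
    also have "\<dots> \<longleftrightarrow> (a * cnj a) * w\<^sup>2 = (w * cnj w) * (a * b)"
      by (simp add: power2_eq_square mult_ac)
    also have "\<dots> \<longleftrightarrow> w\<^sup>2 = a * b" using sq assms by simp
    finally show ?thesis .
  qed
  finally show ?thesis .
qed

text \<open>A common bisector meets the circle in a point whose square is both products.\<close>
lemma coord_mult_eq_if_bisector_eq:
  assumes r: "dist m a = r" "dist m b = r" "dist m z = r" "dist m q = r"
    and "z \<noteq> q" and eq: "perp_bisector z q = perp_bisector a b"
  shows "coord m z * coord m q = coord m a * coord m b"
proof -
  have "r > 0"
    using r \<open>z \<noteq> q\<close> by (metis dist_eq_0_iff zero_less_dist_iff)
  obtain w where w: "coord m w = csqrt (coord m a * coord m b)" using surj_coord by metis
  have w2: "(coord m w)\<^sup>2 = coord m a * coord m b" by (simp add: w)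
  have "(dist m w)\<^sup>2 = r\<^sup>2"
    using arg_cong[OF w2, of norm] r by (simp add: norm_power norm_mult norm_coord power2_eq_square)
  then have wr: "dist m w = r" using \<open>r > 0\<close> by simp
  have equidistant_iff: "dist w x = dist w y \<longleftrightarrow>
      x = y \<or> coord m a * coord m b = coord m x * coord m y"
    if "dist m x = r" "dist m y = r" for x y
    using circle_equidistant_iff[of "coord m w" r "coord m x" "coord m y"] that wr \<open>r > 0\<close>
    by (simp add: norm_coord dist_coord coord_eq_iff w2)
  have "w \<in> perp_bisector a b"
    using equidistant_iff[of a b] r by (simp add: perp_bisector_def)
  then have "dist w z = dist w q" using eq by (auto simp: perp_bisector_def)
  then show ?thesis
    using equidistant_iff[of z q] r \<open>z \<noteq> q\<close> by simp
qed

lemma equal_products_square: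
  fixes A :: "complex set"
  assumes A: "a \<in> A" "b \<in> A" "c \<in> A" and ne: "a \<noteq> b" "a \<noteq> c" "b \<noteq> c" and nz: "0 \<notin> A"
    and closed: "\<And>x y z. \<lbrakk>x \<in> A; y \<in> A; x \<noteq> y; z \<in> A\<rbrakk> \<Longrightarrow> x * y / z \<in> A"
  obtains x y where "x \<in> A" "y \<in> A" "x \<noteq> y" "a\<^sup>2 = x * y"
proof -
  have nz': "a \<noteq> 0" "b \<noteq> 0" "c \<noteq> 0" using A nz by auto
  have image: "a\<^sup>2 / x \<in> A" if x: "x \<in> A" for x
  proof -
    have "x \<noteq> 0" using x nz by auto
    have "b * c / (a * c / x) \<in> A" using closed[of b c "a * c / x"] closed[of a c x] A ne x by simp
    then have "a * b / (b * c / (a * c / x)) \<in> A" using closed[of a b] A ne by blast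
    also have "a * b / (b * c / (a * c / x)) = a\<^sup>2 / x"
      using nz' \<open>x \<noteq> 0\<close> by (simp add: field_simps power2_eq_square)
    finally show ?thesis .
  qed
  have "b\<^sup>2 \<noteq> a\<^sup>2 \<or> c\<^sup>2 \<noteq> a\<^sup>2" using ne by (auto simp: power2_eq_iff)
  then obtain x where x: "x \<in> A" "x\<^sup>2 \<noteq> a\<^sup>2" using A by blast
  then have "x \<noteq> 0" using nz by auto
  show thesis
    by (rule that[of x "a\<^sup>2 / x"])
      (use x image \<open>x \<noteq> 0\<close> in \<open>auto simp: field_simps power2_eq_square\<close>)
qed

section \<open>The lower bound\<close>

theorem proposition3:
  fixes P :: "(real^2) set" and n :: nat
  assumes "finite P" and "card P = n" and "n > 2"
  shows "card (perp_bisectors P) \<ge> n"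
proof (rule ccontr)
  assume "\<not> card (perp_bisectors P) \<ge> n"
  then have few: "card (perp_bisectors P) < card P" using assms by simp
  have mirror: "\<exists>q\<in>P. q \<noteq> z \<and> perp_bisector z q = perp_bisector a b"
    if "a \<in> P" "b \<in> P" "a \<noteq> b" "z \<in> P" for a b z
    by (rule mirror_image_in_set[OF \<open>finite P\<close> few \<open>z \<in> P\<close>, of "perp_bisector a b"])
      (use that in \<open>auto simp: perp_bisectors_def\<close>)
  have "3 \<le> card P" using assms by simp
  then obtain T where "T \<subseteq> P" "card T = 3" by (rule obtain_subset_with_card_n)
  then obtain a b c where abc: "a \<in> P" "b \<in> P" "c \<in> P" "a \<noteq> b" "a \<noteq> c" "b \<noteq> c"
    by (auto simp: card_3_iff)
  obtain m r where r: "\<And>p. p \<in> P \<Longrightarrow> dist m p = r"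
    by (rule concyclic_if_mirror_closed[of P]) (use \<open>finite P\<close> abc mirror in blast)+
  have "r > 0" using r abc by (metis dist_eq_0_iff zero_less_dist_iff)
  have nz: "0 \<notin> coord m ` P" using r \<open>r > 0\<close> norm_coord by (metis imageE less_irrefl norm_zero)
  have closed: "x * y / z \<in> coord m ` P"
    if mem: "x \<in> coord m ` P" "y \<in> coord m ` P" "x \<noteq> y" "z \<in> coord m ` P" for x y z
  proof -
    obtain x' y' z' where xyz: "x' \<in> P" "x = coord m x'" "y' \<in> P" "y = coord m y'"
      "z' \<in> P" "z = coord m z'"
      using mem by blast
    then obtain q where q: "q \<in> P" "q \<noteq> z'" "perp_bisector z' q = perp_bisector x' y'"
      using mirror[of x' y' z'] \<open>x \<noteq> y\<close> by blast
    then have "z * coord m q = x * y"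
      using coord_mult_eq_if_bisector_eq[of m x' r y' z' q] r xyz by simp
    moreover have "z \<noteq> 0" using nz mem by auto
    ultimately have "x * y / z = coord m q" by (simp add: field_simps)
    then show ?thesis using q by simp
  qed
  obtain x y where xy: "x \<in> P" "y \<in> P" "x \<noteq> y" "(coord m a)\<^sup>2 = coord m x * coord m y"
    by (rule equal_products_square[of "coord m a" "coord m ` P" "coord m b" "coord m c"])
      (use abc nz closed in \<open>auto simp: coord_eq_iff\<close>)
  have "dist a x = dist a y"
    using circle_equidistant_iff[of "coord m a" r "coord m x" "coord m y"] xy r abc \<open>r > 0\<close>
    by (simp add: norm_coord dist_coord)
  then have "a \<in> perp_bisector x y" by (simp add: perp_bisector_def)
  moreover obtain q where "q \<noteq> a" "perp_bisector a q = perp_bisector x y"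
    using mirror[of x y a] xy abc by blast
  ultimately have "a \<in> perp_bisector a q" by simp
  then show False using \<open>q \<noteq> a\<close> by (simp add: perp_bisector_def)
qed

end
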